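(* Let $I=(\mathcal{E},D,c,f)$ be a CMP instance whose objective $f$ is of type sum, product, or bottleneck. Then: (a) $l'_I(e)=l_I(e)$ for each $e\in \mathcal{E}\setminus\bigcap_{S^*\in D^*}S^*$. (b) $l'_I(E)=l_I(E)$ for each $E\subseteq\mathcal{E}$ such that there exists $S^*\in D^*$ with $E\subseteq\mathcal{E}\setminus S^*$. (c) $\bar l'_I(E)=\bar l_I(E)$ for each $E\subseteq\mathcal{E}$ such that there exists $S^*\in D^*$ with $E\subseteq\mathcal{E}\setminus S^*$.
   Context: A combinatorial minimization problem (CMP) instance is $I=(\mathcal{E},D,c,f)$ where $\mathcal{E}$ is a finite ground set, $D\subseteq 2^{\mathcal{E}}\setminus\{\emptyset\}$ is a nonempty set of feasible solutions, $c:\mathcal{E}\to\mathbb{R}$ is a cost function, and $f:D\to\mathbb{R}$ is of one of three types: sum, $f(S)=\sum_{a\in S}c(a)$; product, $f(S)=\prod_{a\in S}c(a)$, where for this type all costs are positive; bottleneck, $f(S)=\max_{a\in S}c(a)$. An optimal solution is an $S^*\in D$ minimizing $f$; $D^*$ is the set of optimal solutions and $f(I)$ the optimal value. For $E=\{e_1,\dots,e_k\}\subseteq\mathcal{E}$ and $\vec\alpha\in\mathbb{R}^k$, $I_{-\vec\alpha,E}$ is the instance with costs $c(e_l)-\alpha_l$ on $e_l$ ($l=1,\dots,k$), unchanged costs elsewhere, and objective $f_{-\vec\alpha,E}$ of the same type as $f$ computed with these costs; $f_{-\vec\alpha,E}(I_{-\vec\alpha,E})$ denotes its optimal value. Let $\mathrm{maxdec}(e)=\infty$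 if $f$ is of type sum or bottleneck and $\mathrm{maxdec}(e)=c(e)$ if $f$ is of type product. Call $\vec\alpha$ admissible for $E$ if $0\le\alpha_l<\mathrm{maxdec}(e_l)$ for all $l$. Tolerances take values in $\mathbb{R}\cup\{\infty\}$; $\sup$ of an unbounded set and $\inf\emptyset$ are $\infty$. New lower tolerances (any $E\subseteq\mathcal{E}$): $l'_I(E)=\sup\{\alpha\mid \exists$ admissible $\vec\alpha$ with $\sum_l\alpha_l=\alpha$ and $f_{-\vec\alpha,E}(I_{-\vec\alpha,E})=f(I)\}$; $\bar l'_I(E)=\inf\{\alpha\mid \exists$ admissible $\vec\alpha$ with $\sum_l\alpha_l=\alpha$ and $f_{-\vec\alpha,E}(I_{-\vec\alpha,E})<f(I)\}$; for $e\in\mathcal{E}$, $l'_I(e)=l'_I(\{e\})$. Current lower tolerances (for $E$ with some $S^*\in D^*$, $E\subseteq\mathcal{E}\setminus S^*$): $l_I(E)=\sup\{\alpha\mid$ for each $S^*\in D^*$ there is an admissible $\vec\alpha$ with $\sum_l\alpha_l=\alpha$ such that $S^*$ is optimal for $I_{-\vec\alpha,E}\}$; $\bar l_I(E)=\inf\{\alpha\mid$ there exist $S^*\in D^*$ and an admissible $\vec\alpha$ with $\sum_l\alpha_l=\alpha$ such that $S^*$ is not optimal for $I_{-\vec\alpha,E}\}$. For $e\in\mathcal{E}\setminus\bigcap_{S^*\in D^*}S^*$: $l_I(e)=\sup\{\alpha\mid 0\le\alpha<\mathrm{maxdec}(e),\ \text{every } S^*\in D^* \text{ is optimal for } I_{-\alpha,e}\}$.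 *)

theory Defs
  imports Complex_Main "HOL-Library.Extended_Real"
begin

datatype obj_type = SumType | ProductType | BottleneckType

text \<open>The last component of an instance records the type of the objective; together with
  the costs it determines the objective function itself, see \<open>objective\<close>.\<close>

record 'a cmp =
  ground :: "'a set"
  feasible :: "'a set set"
  cost :: "'a \<Rightarrow> real"
  obj_type :: obj_type

definition cmp_instance :: "'a cmp \<Rightarrow> bool" where
  "cmp_instance I \<longleftrightarrow>
     finite (ground I) \<and>
     feasible I \<subseteq> Pow (ground I) - {{}} \<and>
     feasible I \<noteq> {} \<and>
     (obj_type I = ProductType \<longrightarrow> (\<forall>e\<in>ground I. cost I e > 0))"

definition objective :: "'a cmp \<Rightarrow> 'a set \<Rightarrow> real" where
  "objective I S = (case obj_type I of
       SumType \<Rightarrow> (\<Sum>a\<in>S. cost I a)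
     | ProductType \<Rightarrow> (\<Prod>a\<in>S. cost I a)
     | BottleneckType \<Rightarrow> Max (cost I ` S))"

definition optimal_solutions :: "'a cmp \<Rightarrow> 'a set set" where
  "optimal_solutions I = {S \<in> feasible I. \<forall>T\<in>feasible I. objective I S \<le> objective I T}"

definition optimal_value :: "'a cmp \<Rightarrow> real" where
  "optimal_value I = Min (objective I ` feasible I)"

text \<open>A vector of decreases for \<open>E\<close> is indexed by the elements of \<open>E\<close> themselves instead of by
  an enumeration of \<open>E\<close>: it is a function whose values outside \<open>E\<close> are irrelevant.\<close>

definition decrease :: "'a cmp \<Rightarrow> ('a \<Rightarrow> real) \<Rightarrow> 'a set \<Rightarrow> 'a cmp" where
  "decrease I \<alpha> E = I\<lparr>cost := (\<lambda>e. if e \<in> E then cost I e - \<alpha> e else cost I e)\<rparr>"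

definition maxdec :: "'a cmp \<Rightarrow> 'a \<Rightarrow> ereal" where
  "maxdec I e = (case obj_type I of
       SumType \<Rightarrow> \<infinity>
     | ProductType \<Rightarrow> ereal (cost I e)
     | BottleneckType \<Rightarrow> \<infinity>)"

definition admissible :: "'a cmp \<Rightarrow> ('a \<Rightarrow> real) \<Rightarrow> 'a set \<Rightarrow> bool" where
  "admissible I \<alpha> E \<longleftrightarrow> (\<forall>e\<in>E. 0 \<le> \<alpha> e \<and> ereal (\<alpha> e) < maxdec I e)"

definition new_lower_tol :: "'a cmp \<Rightarrow> 'a set \<Rightarrow> ereal" where
  "new_lower_tol I E = Sup {ereal t | t. \<exists>\<alpha>. admissible I \<alpha> E \<and> (\<Sum>e\<in>E. \<alpha> e) = t \<and>
     optimal_value (decrease I \<alpha> E) = optimal_value I}"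

definition new_lower_tol_bar :: "'a cmp \<Rightarrow> 'a set \<Rightarrow> ereal" where
  "new_lower_tol_bar I E = Inf {ereal t | t. \<exists>\<alpha>. admissible I \<alpha> E \<and> (\<Sum>e\<in>E. \<alpha> e) = t \<and>
     optimal_value (decrease I \<alpha> E) < optimal_value I}"

definition new_lower_tol_elem :: "'a cmp \<Rightarrow> 'a \<Rightarrow> ereal" where
  "new_lower_tol_elem I e = new_lower_tol I {e}"

text \<open>The three current tolerances below are meaningful only if some optimal solution avoids
  \<open>E\<close> (respectively \<open>e\<close>).\<close>

definition cur_lower_tol :: "'a cmp \<Rightarrow> 'a set \<Rightarrow> ereal" where
  "cur_lower_tol I E = Sup {ereal t | t. \<forall>S\<in>optimal_solutions I.
     \<exists>\<alpha>. admissible I \<alpha> E \<and> (\<Sum>e\<in>E. \<alpha> e) = t \<and> S \<in> optimal_solutions (decrease I \<alpha> E)}"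

definition cur_lower_tol_bar :: "'a cmp \<Rightarrow> 'a set \<Rightarrow> ereal" where
  "cur_lower_tol_bar I E = Inf {ereal t | t. \<exists>S\<in>optimal_solutions I.
     \<exists>\<alpha>. admissible I \<alpha> E \<and> (\<Sum>e\<in>E. \<alpha> e) = t \<and> S \<notin> optimal_solutions (decrease I \<alpha> E)}"

definition cur_lower_tol_elem :: "'a cmp \<Rightarrow> 'a \<Rightarrow> ereal" where
  "cur_lower_tol_elem I e = Sup {ereal t | t. 0 \<le> t \<and> ereal t < maxdec I e \<and>
     (\<forall>S\<in>optimal_solutions I. S \<in> optimal_solutions (decrease I (\<lambda>_. t) {e}))}"

end

theory Submission
  imports Defs
begin

text \<open>An admissible decrease on \<open>E\<close> never raises the objective and leaves it unchanged on solutions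
  that avoid \<open>E\<close>. Hence, if some optimal solution avoids \<open>E\<close>, the optimal value is kept iff that
  solution stays optimal, and in this case all optimal solutions stay optimal. So the sets whose
  suprema (infima) define the two kinds of tolerances coincide.\<close>

lemma feasible_decrease [simp]: "feasible (decrease I \<alpha> E) = feasible I"
  by (simp add: decrease_def)

lemma obj_type_decrease [simp]: "obj_type (decrease I \<alpha> E) = obj_type I"
  by (simp add: decrease_def)

lemma cost_decrease [simp]:
  "cost (decrease I \<alpha> E) e = (if e \<in> E then cost I e - \<alpha> e else cost I e)"
  by (simp add: decrease_def)

text \<open>No single cost increases, since \<alpha> is nonnegative on \<open>E\<close>. Sums and
  maxima are monotone in the costs; products are monotone only for nonnegative factors, which is why
  positivity is assumed in that case. \<open>Max\<close> needs \<open>S\<close> finite and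
  nonempty.\<close>

lemma objective_decrease_le:
  assumes S: "finite S" "S \<noteq> {}" and adm: "admissible I \<alpha> E"
    and pos: "obj_type I = ProductType \<Longrightarrow> \<forall>e\<in>S. cost I e > 0"
  shows "objective (decrease I \<alpha> E) S \<le> objective I S"
proof -
  have le: "cost (decrease I \<alpha> E) e \<le> cost I e" for e
    using adm by (auto simp: admissible_def)
  show ?thesis
  proof (cases "obj_type I")
    case SumType
    then show ?thesis
      using le by (simp add: objective_def sum_mono del: cost_decrease)
  next
    case ProductType
    \<comment> \<open>On \<open>E\<close> admissibility bounds \<alpha> strictly by
      \<open>maxdec\<close>, here the cost itself, so the decreased factor stays positive; off
      \<open>E\<close> the factor is the old positive cost.\<close>
    have "0 \<le> cost (decrease I \<alpha> E) e" if "e \<in> S" for e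
      using adm pos[OF ProductType] that ProductType
      by (auto simp: admissible_def maxdec_def less_imp_le)
    with ProductType le show ?thesis
      by (simp add: objective_def prod_mono del: cost_decrease)
  next
    case BottleneckType
    have "cost (decrease I \<alpha> E) e \<le> Max (cost I ` S)" if "e \<in> S" for e
      using le[of e] Max_ge[of "cost I ` S" "cost I e"] S that
      by (meson finite_imageI imageI order_trans)
    with BottleneckType S show ?thesis
      by (auto simp: objective_def simp del: cost_decrease)
  qed
qed

lemma objective_decrease_disjoint:
  assumes "S \<inter> E = {}"
  shows "objective (decrease I \<alpha> E) S = objective I S"
proof -
  have "cost (decrease I \<alpha> E) e = cost I e" if "e \<in> S" for e
    using assms that by auto
  then show ?thesis
    by (auto simp: objective_def simp del: cost_decrease cong: sum.cong prod.cong image_cong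
        split: obj_type.split)
qed

text \<open>Finiteness makes \<open>Min\<close> a true lower bound. Optimality thus becomes an
  equation between reals, which allows comparing an instance with its decreased version by values
  alone.\<close>

lemma optimal_solutions_iff:
  assumes "finite (feasible I)"
  shows "S \<in> optimal_solutions I \<longleftrightarrow> S \<in> feasible I \<and> objective I S = optimal_value I"
  using assms unfolding optimal_solutions_def optimal_value_def
  by (auto intro!: Min_eqI[symmetric] simp: Min_le)

lemma
  assumes I: "cmp_instance I" and S0: "S0 \<in> optimal_solutions I" "S0 \<inter> E = {}"
    and adm: "admissible I \<alpha> E"
  shows optimal_value_decrease_le: "optimal_value (decrease I \<alpha> E) \<le> optimal_value I"
    and optimal_solutions_decrease_iff:
      "S0 \<in> optimal_solutions (decrease I \<alpha> E) \<longleftrightarrow>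
        optimal_value (decrease I \<alpha> E) = optimal_value I"
    and optimal_solutions_decrease_mono:
      "\<lbrakk>optimal_value (decrease I \<alpha> E) = optimal_value I; S \<in> optimal_solutions I\<rbrakk>
        \<Longrightarrow> S \<in> optimal_solutions (decrease I \<alpha> E)"
proof -
  have fin: "finite (feasible I)"
    using I unfolding cmp_instance_def by (meson Diff_subset finite_Pow_iff finite_subset)
  \<comment> \<open>Decreasing costs keeps the feasible set, so \<open>fin\<close> serves both
    instances.\<close>
  note opt = optimal_solutions_iff[OF fin]
    optimal_solutions_iff[of "decrease I \<alpha> E", simplified, OF fin]
  have Min_le: "optimal_value (decrease I \<alpha> E) \<le> objective (decrease I \<alpha> E) T"
    if "T \<in> feasible I" for T
    using fin that by (simp add: optimal_value_def)
  have le: "objective (decrease I \<alpha> E) T \<le> objective I T" if "T \<in> feasible I" for T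
  proof (rule objective_decrease_le[OF _ _ adm])
    have T: "T \<subseteq> ground I" "T \<noteq> {}" and ground: "finite (ground I)"
      using I that by (auto simp: cmp_instance_def)
    show "finite T"
      using T(1) ground by (rule finite_subset)
    show "T \<noteq> {}"
      by (rule T(2))
    show "\<forall>e\<in>T. cost I e > 0" if "obj_type I = ProductType"
      using I T(1) that by (auto simp: cmp_instance_def)
  qed
  show *: "optimal_value (decrease I \<alpha> E) \<le> optimal_value I"
    using S0 Min_le[of S0] objective_decrease_disjoint[OF S0(2)] by (simp add: opt)
  show "S0 \<in> optimal_solutions (decrease I \<alpha> E) \<longleftrightarrow>
        optimal_value (decrease I \<alpha> E) = optimal_value I"
    using S0 objective_decrease_disjoint[OF S0(2)] by (auto simp: opt)
  \<comment> \<open>The new objective of \<open>S\<close> is squeezed between the new optimal value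
    and its old objective, the old optimal value; these two agree by assumption. \<open>S\<close>
    itself may meet \<open>E\<close>.\<close>
  show "S \<in> optimal_solutions (decrease I \<alpha> E)"
    if "optimal_value (decrease I \<alpha> E) = optimal_value I" "S \<in> optimal_solutions I"
    using that Min_le[of S] le[of S] by (simp add: opt)
qed

text \<open>On the right \<alpha> may depend on \<open>S\<close>. A value-preserving \<alpha> serves
  all \<open>S\<close> at once; conversely, the \<alpha> belonging to \<open>S0\<close> preserves
  the value.\<close>

lemma new_lower_tol_eq_cur_lower_tol:
  assumes "cmp_instance I" "S0 \<in> optimal_solutions I" "S0 \<inter> E = {}"
  shows "new_lower_tol I E = cur_lower_tol I E"
proof -
  have "(\<exists>\<alpha>. admissible I \<alpha> E \<and> (\<Sum>e\<in>E. \<alpha> e) = t \<and>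
          optimal_value (decrease I \<alpha> E) = optimal_value I) \<longleftrightarrow>
        (\<forall>S\<in>optimal_solutions I. \<exists>\<alpha>. admissible I \<alpha> E \<and> (\<Sum>e\<in>E. \<alpha> e) = t \<and>
          S \<in> optimal_solutions (decrease I \<alpha> E))" for t
    using assms(2) optimal_solutions_decrease_iff[OF assms]
      optimal_solutions_decrease_mono[OF assms] by blast
  then show ?thesis
    by (simp add: new_lower_tol_def cur_lower_tol_def)
qed

text \<open>Here the conditions agree already for each fixed \<alpha>: if the value drops,
  \<open>S0\<close> loses optimality, and if it does not drop, it is unchanged and no optimal
  solution is lost. The two existential quantifiers then commute.\<close>

lemma new_lower_tol_bar_eq_cur_lower_tol_bar:
  assumes "cmp_instance I" "S0 \<in> optimal_solutions I" "S0 \<inter> E = {}"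
  shows "new_lower_tol_bar I E = cur_lower_tol_bar I E"
proof -
  have "optimal_value (decrease I \<alpha> E) < optimal_value I \<longleftrightarrow>
        (\<exists>S\<in>optimal_solutions I. S \<notin> optimal_solutions (decrease I \<alpha> E))"
    if "admissible I \<alpha> E" for \<alpha>
    using assms(2) that optimal_value_decrease_le[OF assms that]
      optimal_solutions_decrease_iff[OF assms that]
      optimal_solutions_decrease_mono[OF assms that] by (metis order_less_le)
  then have "(\<exists>\<alpha>. admissible I \<alpha> E \<and> (\<Sum>e\<in>E. \<alpha> e) = t \<and>
          optimal_value (decrease I \<alpha> E) < optimal_value I) \<longleftrightarrow>
        (\<exists>S\<in>optimal_solutions I. \<exists>\<alpha>. admissible I \<alpha> E \<and> (\<Sum>e\<in>E. \<alpha> e) = t \<and>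
          S \<notin> optimal_solutions (decrease I \<alpha> E))" for t
    by blast
  then show ?thesis
    by (simp add: new_lower_tol_bar_def cur_lower_tol_bar_def)
qed

text \<open>The element version ranges over numbers rather than vectors, so vectors on
  \<open>{e}\<close> must first be identified with their value at \<open>e\<close>.\<close>

lemma new_lower_tol_elem_eq_cur_lower_tol_elem:
  assumes "cmp_instance I" "S0 \<in> optimal_solutions I" "e \<notin> S0"
  shows "new_lower_tol_elem I e = cur_lower_tol_elem I e"
proof -
  have S0: "S0 \<inter> {e} = {}"
    using assms(3) by simp
  \<comment> \<open>Only the value at \<open>e\<close> is read, so any \<alpha> can be replaced by a
    constant function without changing the instance.\<close>
  have decrease_const: "decrease I \<alpha> {e} = decrease I (\<lambda>_. \<alpha> e) {e}" for \<alpha>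
    by (simp add: decrease_def cong: if_cong)
  have adm: "admissible I \<alpha> {e} \<longleftrightarrow> 0 \<le> \<alpha> e \<and> ereal (\<alpha> e) < maxdec I e" for \<alpha>
    by (simp add: admissible_def)
  have eq: "optimal_value (decrease I (\<lambda>_. t) {e}) = optimal_value I \<longleftrightarrow>
      (\<forall>S\<in>optimal_solutions I. S \<in> optimal_solutions (decrease I (\<lambda>_. t) {e}))"
    if "0 \<le> t" "ereal t < maxdec I e" for t
  proof -
    have "admissible I (\<lambda>_. t) {e}"
      using that by (simp add: adm)
    then show ?thesis
      using assms(2) optimal_solutions_decrease_iff[OF assms(1,2) S0]
        optimal_solutions_decrease_mono[OF assms(1,2) S0] by blast
  qed
  have "(\<exists>\<alpha>. admissible I \<alpha> {e} \<and> (\<Sum>e\<in>{e}. \<alpha> e) = t \<and>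
          optimal_value (decrease I \<alpha> {e}) = optimal_value I) \<longleftrightarrow>
        0 \<le> t \<and> ereal t < maxdec I e \<and>
          optimal_value (decrease I (\<lambda>_. t) {e}) = optimal_value I" (is "?L t \<longleftrightarrow> ?R t") for t
  proof
    show "?R t" if "?L t"
      using that decrease_const by (auto simp: adm)
    show "?L t" if "?R t"
      using that by (intro exI[of _ "\<lambda>_. t"]) (simp add: adm)
  qed
  also have "?R t \<longleftrightarrow> 0 \<le> t \<and> ereal t < maxdec I e \<and>
      (\<forall>S\<in>optimal_solutions I. S \<in> optimal_solutions (decrease I (\<lambda>_. t) {e}))" for t
    using eq[of t] by blast
  finally show ?thesis
    unfolding new_lower_tol_elem_def new_lower_tol_def cur_lower_tol_elem_def by simp
qed

theorem theorem3:
  fixes I :: "'a cmp"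
  assumes "cmp_instance I"
  shows "(\<forall>e \<in> ground I - \<Inter> (optimal_solutions I).
            new_lower_tol_elem I e = cur_lower_tol_elem I e)
       \<and> (\<forall>E. E \<subseteq> ground I \<longrightarrow> (\<exists>S\<in>optimal_solutions I. E \<subseteq> ground I - S) \<longrightarrow>
            new_lower_tol I E = cur_lower_tol I E)
       \<and> (\<forall>E. E \<subseteq> ground I \<longrightarrow> (\<exists>S\<in>optimal_solutions I. E \<subseteq> ground I - S) \<longrightarrow>
            new_lower_tol_bar I E = cur_lower_tol_bar I E)"
proof (intro conjI ballI allI impI)
  fix e assume "e \<in> ground I - \<Inter> (optimal_solutions I)"
  \<comment> \<open>Lying outside the intersection means that some optimal solution omits
    \<open>e\<close>; it takes the role of \<open>S0\<close>.\<close>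
  then show "new_lower_tol_elem I e = cur_lower_tol_elem I e"
    using new_lower_tol_elem_eq_cur_lower_tol_elem[OF assms] by blast
next
  fix E assume "\<exists>S\<in>optimal_solutions I. E \<subseteq> ground I - S"
  then obtain S where S: "S \<in> optimal_solutions I" "S \<inter> E = {}"
    by blast
  show "new_lower_tol I E = cur_lower_tol I E"
    using new_lower_tol_eq_cur_lower_tol[OF assms S] .
  show "new_lower_tol_bar I E = cur_lower_tol_bar I E"
    using new_lower_tol_bar_eq_cur_lower_tol_bar[OF assms S] .
qed

end
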